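(* Let $G$ be a connected topological group, let $\mathcal{H}$ be a complex Hilbert space and let $\pi\colon G \to \mathrm{PU}(\mathcal{H})$ be an irreducible projective unitary representation (a group homomorphism, not assumed continuous). If there exists at least one ray $[v]\in\mathbb{P}(\mathcal{H})$ whose orbit map $G \to \mathbb{P}(\mathcal{H})$, $g \mapsto \pi(g)[v]$, is continuous, then $\pi$ is continuous.
   Context: $\mathrm{U}(\mathcal{H})$ carries the strong operator topology, $\mathbb{T} = \{z\in\mathbb{C} : |z|=1\}$, and $\mathrm{PU}(\mathcal{H}) = \mathrm{U}(\mathcal{H})/\mathbb{T}\mathbf{1}$ carries the quotient topology. $\mathbb{P}(\mathcal{H})$ is the projective space of one-dimensional subspaces (rays) $[v] = \mathbb{C}v$, $0\neq v\in\mathcal{H}$, with the quotient topology from the unit sphere $\mathbb{S}(\mathcal{H})$ (norm topology). $\mathrm{PU}(\mathcal{H})$ acts naturally on $\mathbb{P}(\mathcal{H})$ and on the set of closed subspaces of $\mathcal{H}$; $\pi$ is irreducible if the only $\pi(G)$-invariant closed subspaces are $\{0\}$ and $\mathcal{H}$. *)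

theory Defs
  imports "HOL-Analysis.Analysis" "HOL-Algebra.Coset"
begin

section \<open>Complex Hilbert spaces\<close>

text \<open>
  The inner product is antilinear in the first argument. The last axiom says that the given
  norm is the one induced by the inner product; it contains positive definiteness.
  Completeness comes from the class \<^class>\<open>banach\<close>.
\<close>

class chilbert_space = banach +
  fixes scaleC :: "complex \<Rightarrow> 'a \<Rightarrow> 'a"  (infixr \<open>*\<^sub>C\<close> 75)
    and cinner :: "'a \<Rightarrow> 'a \<Rightarrow> complex"
  assumes scaleC_add_right: "a *\<^sub>C (x + y) = a *\<^sub>C x + a *\<^sub>C y"
    and scaleC_add_left: "(a + b) *\<^sub>C x = a *\<^sub>C x + b *\<^sub>C x"
    and scaleC_scaleC: "a *\<^sub>C b *\<^sub>C x = (a * b) *\<^sub>C x"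
    and scaleC_of_real: "complex_of_real r *\<^sub>C x = r *\<^sub>R x"
    and cinner_commute: "cinner x y = cnj (cinner y x)"
    and cinner_add_right: "cinner x (y + z) = cinner x y + cinner x z"
    and cinner_scaleC_right: "cinner x (a *\<^sub>C y) = a * cinner x y"
    and cinner_self: "cinner x x = complex_of_real ((norm x)\<^sup>2)"

instantiation complex :: chilbert_space
begin

definition scaleC_complex :: "complex \<Rightarrow> complex \<Rightarrow> complex"
  where "scaleC_complex a x = a * x"

definition cinner_complex :: "complex \<Rightarrow> complex \<Rightarrow> complex"
  where "cinner_complex x y = cnj x * y"

instance
proof
  show "cinner x x = complex_of_real ((norm x)\<^sup>2)" for x :: complex
    unfolding cinner_complex_def complex_norm_square by (rule mult.commute)
qed (simp_all add: scaleC_complex_def cinner_complex_def distrib_left distrib_right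
       scaleR_conv_of_real mult.assoc mult.left_commute mult.commute)

end

definition csubspace :: "'h::chilbert_space set \<Rightarrow> bool"
  where "csubspace S \<longleftrightarrow>
    0 \<in> S \<and> (\<forall>x\<in>S. \<forall>y\<in>S. x + y \<in> S) \<and> (\<forall>c. \<forall>x\<in>S. c *\<^sub>C x \<in> S)"


section \<open>Topological groups and quotient topologies\<close>

text \<open>No separation axiom is imposed on topological groups.\<close>

locale topological_group = group G for G (structure) +
  fixes T :: "'a topology"
  assumes topspace_eq_carrier: "topspace T = carrier G"
    and continuous_mult: "continuous_map (prod_topology T T) T (\<lambda>(x, y). x \<otimes> y)"
    and continuous_inv: "continuous_map T T (\<lambda>x. inv x)"

definition quotient_topology :: "'a topology \<Rightarrow> ('a \<Rightarrow> 'b) \<Rightarrow> 'b topology"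
  where "quotient_topology X q =
    topology (\<lambda>W. W \<subseteq> q ` topspace X \<and> openin X {x \<in> topspace X. q x \<in> W})"

lemma openin_quotient_topology:
  "openin (quotient_topology X q) W \<longleftrightarrow>
    W \<subseteq> q ` topspace X \<and> openin X {x \<in> topspace X. q x \<in> W}"
proof -
  have "istopology (\<lambda>W. W \<subseteq> q ` topspace X \<and> openin X {x \<in> topspace X. q x \<in> W})"
    unfolding istopology_def
  proof (intro conjI allI impI)
    fix S T
    assume S: "S \<subseteq> q ` topspace X \<and> openin X {x \<in> topspace X. q x \<in> S}"
      and T: "T \<subseteq> q ` topspace X \<and> openin X {x \<in> topspace X. q x \<in> T}"
    show "S \<inter> T \<subseteq> q ` topspace X" using S by blast
    have "{x \<in> topspace X. q x \<in> S \<inter> T} = {x \<in> topspace X. q x \<in> S} \<inter> {x \<in> topspace X. q x \<in> T}"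
      by blast
    then show "openin X {x \<in> topspace X. q x \<in> S \<inter> T}"
      using S T by (simp add: openin_Int)
  next
    fix \<K>
    assume K: "\<forall>W\<in>\<K>. W \<subseteq> q ` topspace X \<and> openin X {x \<in> topspace X. q x \<in> W}"
    show "\<Union>\<K> \<subseteq> q ` topspace X" using K by blast
    have "{x \<in> topspace X. q x \<in> \<Union>\<K>} = (\<Union>W\<in>\<K>. {x \<in> topspace X. q x \<in> W})"
      by blast
    then show "openin X {x \<in> topspace X. q x \<in> \<Union>\<K>}"
      using K by auto
  qed
  then show ?thesis
    by (simp add: quotient_topology_def topology_inverse')
qed

lemma topspace_quotient_topology: "topspace (quotient_topology X q) = q ` topspace X"
proof
  show "topspace (quotient_topology X q) \<subseteq> q ` topspace X"
    using openin_quotient_topology[of X q] openin_topspace by blast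
  have "{x \<in> topspace X. q x \<in> q ` topspace X} = topspace X" by blast
  then have "openin (quotient_topology X q) (q ` topspace X)"
    by (simp add: openin_quotient_topology)
  then show "q ` topspace X \<subseteq> topspace (quotient_topology X q)"
    by (rule openin_subset)
qed


section \<open>The unitary and the projective unitary group\<close>

definition unitary :: "('h::chilbert_space \<Rightarrow>\<^sub>L 'h) \<Rightarrow> bool"
  where "unitary U \<longleftrightarrow>
    (\<forall>c x. blinfun_apply U (c *\<^sub>C x) = c *\<^sub>C blinfun_apply U x) \<and>
    (\<forall>x y. cinner (blinfun_apply U x) (blinfun_apply U y) = cinner x y) \<and>
    surj (blinfun_apply U)"

definition unitary_group :: "('h::chilbert_space \<Rightarrow>\<^sub>L 'h) monoid"
  where "unitary_group = \<lparr>carrier = Collect unitary, mult = (o\<^sub>L), one = id_blinfun\<rparr>"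

definition unitary_topology :: "('h::chilbert_space \<Rightarrow>\<^sub>L 'h) topology"
  where "unitary_topology = subtopology strong_operator_topology (carrier unitary_group)"

definition phase_group :: "('h::chilbert_space \<Rightarrow>\<^sub>L 'h) set"
  where "phase_group =
    {U \<in> carrier unitary_group. \<exists>z. cmod z = 1 \<and> (\<forall>x. blinfun_apply U x = z *\<^sub>C x)}"

definition projective_unitary_group :: "('h::chilbert_space \<Rightarrow>\<^sub>L 'h) set monoid"
  where "projective_unitary_group = unitary_group Mod phase_group"

definition projective_unitary_topology :: "('h::chilbert_space \<Rightarrow>\<^sub>L 'h) set topology"
  where "projective_unitary_topology =
    quotient_topology unitary_topology (\<lambda>U. phase_group #>\<^bsub>unitary_group\<^esub> U)"


section \<open>Projective space and the natural actions\<close>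

definition ray :: "'h::chilbert_space \<Rightarrow> 'h set"
  where "ray v = range (\<lambda>c. c *\<^sub>C v)"

definition projective_space :: "'h::chilbert_space set set"
  where "projective_space = ray ` (- {0})"

definition projective_space_topology :: "'h::chilbert_space set topology"
  where "projective_space_topology = quotient_topology (top_of_set (sphere 0 1)) ray"

text \<open>
  An element of the projective unitary group is a coset \<open>p\<close>. For a complex subspace \<open>S\<close>, all
  representatives \<open>U \<in> p\<close> have the same image \<open>U ` S\<close>, so the union below is that image.
\<close>

definition pu_act :: "('h::chilbert_space \<Rightarrow>\<^sub>L 'h) set \<Rightarrow> 'h set \<Rightarrow> 'h set"
  where "pu_act p S = (\<Union>U\<in>p. blinfun_apply U ` S)"

definition projective_rep ::
  "('g, 'm) monoid_scheme \<Rightarrow> ('g \<Rightarrow> ('h::chilbert_space \<Rightarrow>\<^sub>L 'h) set) \<Rightarrow> bool"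
  where "projective_rep G \<pi> \<longleftrightarrow> \<pi> \<in> hom G projective_unitary_group"

definition irreducible_rep ::
  "('g, 'm) monoid_scheme \<Rightarrow> ('g \<Rightarrow> ('h::chilbert_space \<Rightarrow>\<^sub>L 'h) set) \<Rightarrow> bool"
  where "irreducible_rep G \<pi> \<longleftrightarrow>
    (\<forall>S. csubspace S \<and> closed S \<and> (\<forall>g\<in>carrier G. pu_act (\<pi> g) S \<subseteq> S)
      \<longrightarrow> S = {0} \<or> S = UNIV)"

end

theory Submission
  imports Defs
begin

text \<open>
  Let \<open>v\<close> be a unit vector on the continuous ray and write \<open>U\<close> for representatives of \<open>\<pi> g\<close> as
  \<open>g\<close> tends to \<open>1\<close>; continuity of the orbit map means that \<open>\<bar>\<langle>v, U v\<rangle>\<bar>\<close> tends to \<open>1\<close>. The vectors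
  \<open>w\<close> with \<open>U w - \<langle>v, U v\<rangle> w \<rightarrow> 0\<close>, i.e. those on which \<open>U\<close> asymptotically acts by the same phase
  as on \<open>v\<close>, form a closed subspace \<open>S\<close> containing \<open>v\<close>. Conjugation shows that \<open>B S \<subseteq> S\<close> whenever
  \<open>B\<close> represents some \<open>\<pi> h\<close> and \<open>B v \<in> S\<close>, and that \<open>B v\<close> also lies on a continuous ray. If
  \<open>\<langle>v, B v\<rangle> \<noteq> 0\<close>, then \<open>\<langle>U v, U B v\<rangle> = \<langle>v, B v\<rangle>\<close> forces the phases on \<open>v\<close> and \<open>B v\<close> to agree, so
  \<open>B v \<in> S\<close>. Hence the \<open>h\<close> with \<open>B v \<in> S\<close> contain a neighbourhood of \<open>1\<close> and are closed under
  products, which makes them open and closed, thus all of \<open>G\<close>. So \<open>S\<close> is invariant, and it is the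
  whole space by irreducibility. Dividing \<open>U\<close> by the phase of \<open>\<langle>v, U v\<rangle>\<close> then gives strong
  convergence to the identity.
\<close>

section \<open>Elementary Hilbert space facts\<close>

lemma cinner_add_left: "cinner (x + y) z = cinner x z + cinner y (z::'h::chilbert_space)"
  by (metis cinner_add_right cinner_commute complex_cnj_add)

lemma cinner_scaleC_left: "cinner (a *\<^sub>C x) y = cnj a * cinner x (y::'h::chilbert_space)"
  by (metis cinner_scaleC_right cinner_commute complex_cnj_mult)

lemma cinner_scaleR_right: "cinner x (r *\<^sub>R y) = r *\<^sub>R cinner x (y::'h::chilbert_space)"
  by (metis scaleC_of_real cinner_scaleC_right scaleR_conv_of_real)

lemma cinner_scaleR_left: "cinner (r *\<^sub>R x) y = r *\<^sub>R cinner x (y::'h::chilbert_space)"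
  by (metis scaleC_of_real cinner_scaleC_left scaleR_conv_of_real complex_cnj_complex_of_real)

lemma cinner_diff_right: "cinner x (y - z) = cinner x y - cinner x (z::'h::chilbert_space)"
  by (metis add_diff_cancel_right' cinner_add_right diff_add_cancel)

lemma cinner_diff_left: "cinner (x - y) z = cinner x z - cinner y (z::'h::chilbert_space)"
  by (metis add_diff_cancel_right' cinner_add_left diff_add_cancel)

lemma cinner_zero_left [simp]: "cinner 0 (x::'h::chilbert_space) = 0"
  using cinner_diff_left[of x x x] by simp

lemma mult_cnj_cmod: "z * cnj z = (complex_of_real (cmod z))\<^sup>2"
  using complex_norm_square[of z] by simp

text \<open>Expand the inner square of \<open>a *\<^sub>C x\<close> by sesquilinearity and take
  nonnegative square roots.\<close>

lemma norm_scaleC [simp]: "norm (a *\<^sub>C (x::'h::chilbert_space)) = cmod a * norm x"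
proof -
  have "complex_of_real ((norm (a *\<^sub>C x))\<^sup>2) = cnj a * a * cinner x x"
    by (simp only: cinner_self[symmetric] cinner_scaleC_left cinner_scaleC_right mult.assoc
        mult.left_commute)
  also have "\<dots> = complex_of_real ((cmod a * norm x)\<^sup>2)"
    by (simp add: cinner_self power_mult_distrib mult_cnj_cmod mult.commute)
  finally have "(norm (a *\<^sub>C x))\<^sup>2 = (cmod a * norm x)\<^sup>2"
    using of_real_eq_iff by blast
  then show ?thesis
    by (simp add: power2_eq_iff_nonneg)
qed

lemma scaleC_one [simp]: "1 *\<^sub>C (x::'h::chilbert_space) = x"
  using scaleC_of_real[of 1 x] by simp

lemma scaleC_zero_left [simp]: "0 *\<^sub>C (x::'h::chilbert_space) = 0"
  using scaleC_of_real[of 0 x] by simp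

text \<open>Pythagoras for the component of \<open>x\<close> orthogonal to a unit vector. It yields
  Cauchy-Schwarz, and later turns convergence of coefficient moduli into norm convergence.\<close>

lemma norm_diff_projection:
  fixes v x :: "'h::chilbert_space"
  assumes "norm v = 1"
  shows "(norm (x - cinner v x *\<^sub>C v))\<^sup>2 = (norm x)\<^sup>2 - (cmod (cinner v x))\<^sup>2"
proof -
  have "complex_of_real ((norm (x - cinner v x *\<^sub>C v))\<^sup>2)
      = cinner (x - cinner v x *\<^sub>C v) (x - cinner v x *\<^sub>C v)"
    by (rule cinner_self[symmetric])
  also have "\<dots> = cinner x x - cinner v x * cinner x v"
    using assms cinner_self[of v]
    by (simp add: cinner_diff_left cinner_diff_right cinner_scaleC_left cinner_scaleC_right
        right_diff_distrib mult.commute)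
  also have "\<dots> = complex_of_real ((norm x)\<^sup>2 - (cmod (cinner v x))\<^sup>2)"
    using cinner_commute[of x v] by (simp add: cinner_self mult_cnj_cmod)
  finally show ?thesis
    using of_real_eq_iff by blast
qed

lemma norm_cinner_le: "cmod (cinner x y) \<le> norm x * norm (y::'h::chilbert_space)"
proof (cases "x = 0")
  case False
  define v where "v = (1 / norm x) *\<^sub>R x"
  have v: "norm v = 1" and x: "x = norm x *\<^sub>R v"
    using False by (simp_all add: v_def)
  have "(cmod (cinner v y))\<^sup>2 \<le> (norm y)\<^sup>2"
    using norm_diff_projection[OF v, of y]
      zero_le_power2[of "norm (y - cinner v y *\<^sub>C v)"] by linarith
  then have "cmod (cinner v y) \<le> norm y"
    by (simp add: power2_le_iff_abs_le)
  moreover have "cmod (cinner x y) = norm x * cmod (cinner v y)"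
    by (subst x) (simp add: cinner_scaleR_left)
  ultimately show ?thesis
    by (simp add: mult_left_mono)
qed simp

text \<open>Over real scalars the conjugation in the first slot disappears, and Cauchy-Schwarz gives
  the bound. The interpretation below supplies limit and continuity rules.\<close>

lemma bounded_bilinear_cinner: "bounded_bilinear (cinner :: 'h::chilbert_space \<Rightarrow> _)"
proof
  show "\<exists>K. \<forall>x y::'h. norm (cinner x y) \<le> norm x * norm y * K"
    by (rule exI[of _ 1]) (simp add: norm_cinner_le)
qed (simp_all add: cinner_add_left cinner_add_right cinner_scaleR_left cinner_scaleR_right)

lemma bounded_bilinear_scaleC:
  "bounded_bilinear (scaleC :: complex \<Rightarrow> 'h::chilbert_space \<Rightarrow> _)"
proof
  fix r a and x :: 'h
  show "(r *\<^sub>R a) *\<^sub>C x = r *\<^sub>R a *\<^sub>C x"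
    by (simp only: scaleC_of_real[of r "a *\<^sub>C x", symmetric] scaleC_scaleC scaleR_conv_of_real)
  show "a *\<^sub>C r *\<^sub>R x = r *\<^sub>R a *\<^sub>C x"
    by (simp only: scaleC_of_real[symmetric] scaleC_scaleC mult.commute)
  show "\<exists>K. \<forall>a (x::'h). norm (a *\<^sub>C x) \<le> norm a * norm x * K"
    by (rule exI[of _ 1]) simp
qed (simp_all add: scaleC_add_left scaleC_add_right)

interpretation scaleC: bounded_bilinear "scaleC :: complex \<Rightarrow> 'h::chilbert_space \<Rightarrow> _"
  by (rule bounded_bilinear_scaleC)

interpretation cinner: bounded_bilinear "cinner :: 'h::chilbert_space \<Rightarrow> _"
  by (rule bounded_bilinear_cinner)


section \<open>Unitary operators modulo phases\<close>

lemma unitary_norm: "unitary U \<Longrightarrow> norm (blinfun_apply U x) = norm x"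
proof -
  assume "unitary U"
  then have "complex_of_real ((norm (blinfun_apply U x))\<^sup>2) = complex_of_real ((norm x)\<^sup>2)"
    by (metis unitary_def cinner_self)
  then have "(norm (blinfun_apply U x))\<^sup>2 = (norm x)\<^sup>2"
    using of_real_eq_iff by blast
  then show ?thesis
    by (simp add: power2_eq_iff_nonneg)
qed

lemma unitary_scaleC: "unitary U \<Longrightarrow> blinfun_apply U (c *\<^sub>C x) = c *\<^sub>C blinfun_apply U x"
  by (simp add: unitary_def)

lemma unitary_cinner:
  "unitary U \<Longrightarrow> cinner (blinfun_apply U x) (blinfun_apply U y) = cinner x y"
  by (simp add: unitary_def)

lemma unitary_compose: "unitary U \<Longrightarrow> unitary V \<Longrightarrow> unitary (U o\<^sub>L V)"
  unfolding unitary_def by (simp add: comp_surj[unfolded comp_def])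

lemma cnj_mult_unit: "cmod z = 1 \<Longrightarrow> z * cnj z = 1" "cmod z = 1 \<Longrightarrow> cnj z * z = 1"
  using complex_norm_square[of z] by (simp_all add: mult.commute)

definition phase_op :: "complex \<Rightarrow> 'h::chilbert_space \<Rightarrow>\<^sub>L 'h"
  where "phase_op z = Blinfun (scaleC z)"

lemma phase_op_apply [simp]: "blinfun_apply (phase_op z) x = z *\<^sub>C x"
  unfolding phase_op_def by (simp add: bounded_linear_Blinfun_apply scaleC.bounded_linear_right)

lemma phase_op_unitary: "cmod z = 1 \<Longrightarrow> unitary (phase_op z)"
  unfolding unitary_def
proof (intro conjI allI)
  assume z: "cmod z = 1"
  then have "z * cnj z = 1"
    by (rule cnj_mult_unit)
  then show "cinner (blinfun_apply (phase_op z) x) (blinfun_apply (phase_op z) y) = cinner x y"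
    for x y :: 'a
    by (simp add: cinner_scaleC_left cinner_scaleC_right mult.assoc[symmetric])
  show "surj (blinfun_apply (phase_op z :: 'a \<Rightarrow>\<^sub>L 'a))"
    by (rule surjI[of _ "\<lambda>x. cnj z *\<^sub>C x"]) (simp add: scaleC_scaleC \<open>z * cnj z = 1\<close>)
qed (simp add: scaleC_scaleC mult.commute)

lemma phase_group_eq: "phase_group = phase_op ` sphere 0 1"
proof
  show "phase_group \<subseteq> phase_op ` sphere 0 1"
    by (auto simp: phase_group_def intro!: image_eqI blinfun_eqI)
  show "phase_op ` sphere 0 1 \<subseteq> phase_group"
    by (auto simp: phase_group_def unitary_group_def phase_op_unitary)
qed

abbreviation phase_coset :: "('h::chilbert_space \<Rightarrow>\<^sub>L 'h) \<Rightarrow> ('h \<Rightarrow>\<^sub>L 'h) set"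
  where "phase_coset U \<equiv> phase_group #>\<^bsub>unitary_group\<^esub> U"

lemma phase_coset_eq: "phase_coset U = (\<lambda>z. phase_op z o\<^sub>L U) ` sphere 0 1"
  by (auto simp: phase_group_eq r_coset_def unitary_group_def)

lemma phase_op_compose: "phase_op a o\<^sub>L (phase_op b o\<^sub>L U) = phase_op (a * b) o\<^sub>L U"
  by (rule blinfun_eqI) (simp add: scaleC_scaleC)

lemma phase_coset_phase_op:
  assumes "cmod z = 1"
  shows "phase_coset (phase_op z o\<^sub>L U) = phase_coset U"
proof
  show "phase_coset (phase_op z o\<^sub>L U) \<subseteq> phase_coset U"
    using assms by (auto simp: phase_coset_eq phase_op_compose norm_mult)
  have "phase_op w o\<^sub>L U = phase_op (w * cnj z) o\<^sub>L (phase_op z o\<^sub>L U)" for w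
    using assms by (simp add: phase_op_compose mult.assoc cnj_mult_unit)
  then show "phase_coset U \<subseteq> phase_coset (phase_op z o\<^sub>L U)"
    unfolding phase_coset_eq using assms
    by (metis (no_types, lifting) image_eqI image_subsetI complex_mod_cnj mem_sphere_0 mult.right_neutral norm_mult)
qed

text \<open>The topology is pulled back along \<open>blinfun_apply\<close> from a product topology,
  where limits are coordinatewise.\<close>

lemma limitin_strong_operator_topology:
  assumes "\<And>x. ((\<lambda>i. blinfun_apply (f i) x) \<longlongrightarrow> blinfun_apply l x) F"
  shows "limitin strong_operator_topology f l F"
  unfolding limitin_def
proof (intro conjI allI impI)
  fix W
  assume "openin strong_operator_topology W \<and> l \<in> W"
  then obtain V where V: "open V" "W = blinfun_apply -` V" "blinfun_apply l \<in> V"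
    by (auto simp: strong_operator_topology_def openin_pullback_topology)
  have "limitin (product_topology (\<lambda>_. euclidean) UNIV)
      (\<lambda>i. blinfun_apply (f i)) (blinfun_apply l) F"
    using assms by (simp add: limitin_componentwise)
  then have "((\<lambda>i. blinfun_apply (f i)) \<longlongrightarrow> blinfun_apply l) F"
    by (simp only: euclidean_product_topology limitin_canonical_iff)
  from topological_tendstoD[OF this V(1,3)] show "\<forall>\<^sub>F i in F. f i \<in> W"
    by (simp add: V(2))
qed (simp add: strong_operator_topology_topspace)

lemma csubspace_scaleC: "csubspace S \<Longrightarrow> x \<in> S \<Longrightarrow> c *\<^sub>C x \<in> S"
  by (simp add: csubspace_def)

section \<open>Translations and inversion in a topological group\<close>

lemma (in topological_group) openin_left_translate:
  assumes "a \<in> carrier G" "openin T N"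
  shows "openin T {x \<in> carrier G. a \<otimes> x \<in> N}"
proof -
  have "continuous_map T T ((\<lambda>(x, y). x \<otimes> y) \<circ> (\<lambda>x. (a, x)))"
    by (rule continuous_map_compose[OF _ continuous_mult])
       (simp add: continuous_map_pairedI topspace_eq_carrier assms)
  from openin_continuous_map_preimage[OF this assms(2)] show ?thesis
    by (simp add: topspace_eq_carrier)
qed

lemma (in topological_group) openin_right_translate:
  assumes "a \<in> carrier G" "openin T N"
  shows "openin T {x \<in> carrier G. x \<otimes> a \<in> N}"
proof -
  have "continuous_map T T ((\<lambda>(x, y). x \<otimes> y) \<circ> (\<lambda>x. (x, a)))"
    by (rule continuous_map_compose[OF _ continuous_mult])
       (simp add: continuous_map_pairedI topspace_eq_carrier assms)
  from openin_continuous_map_preimage[OF this assms(2)] show ?thesis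
    by (simp add: topspace_eq_carrier)
qed

lemma (in topological_group) openin_inverse:
  assumes "openin T N"
  shows "openin T {x \<in> carrier G. inv x \<in> N}"
  using openin_continuous_map_preimage[OF continuous_inv assms] by (simp add: topspace_eq_carrier)

lemma ray_scaleC: "c \<noteq> 0 \<Longrightarrow> ray (c *\<^sub>C v) = ray v"
proof -
  assume c: "c \<noteq> 0"
  have "a *\<^sub>C v = (a / c) *\<^sub>C c *\<^sub>C v" "a *\<^sub>C c *\<^sub>C v = (a * c) *\<^sub>C v" for a
    using c by (simp_all add: scaleC_scaleC)
  then show ?thesis
    unfolding ray_def by (metis (no_types, lifting) image_subsetI rangeI subset_antisym)
qed

text \<open>Vectors of equal norm on one ray differ by a phase or both vanish. Thus the overlap of
  unit vectors with \<open>v\<close> is a function on projective space.\<close>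

lemma norm_cinner_ray_cong:
  fixes v w :: "'h::chilbert_space"
  assumes "ray w = ray w'" "norm w = norm w'"
  shows "cmod (cinner v w) = cmod (cinner v w')"
proof -
  have "w \<in> ray w'"
    using assms(1) unfolding ray_def by (metis rangeI scaleC_one)
  then obtain c where c: "w = c *\<^sub>C w'"
    by (auto simp: ray_def)
  then show ?thesis
    using assms(2) by (cases "w' = 0") (auto simp: cinner_scaleC_right norm_mult cinner.zero_right)
qed


section \<open>Representations with a continuous ray\<close>

locale projective_unitary_rep = topological_group G T
  for G (structure) and T :: "'g topology" +
  fixes \<pi> :: "'g \<Rightarrow> ('h::chilbert_space \<Rightarrow>\<^sub>L 'h) set"
    and v :: 'h
  assumes hom: "\<pi> \<in> hom G projective_unitary_group"
    and norm_v: "norm v = 1"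
    and orbit: "continuous_map T projective_space_topology (\<lambda>g. pu_act (\<pi> g) (ray v))"
begin

section \<open>Calculus of coset representatives\<close>

lemma rep_coset: "g \<in> carrier G \<Longrightarrow> \<exists>U. unitary U \<and> \<pi> g = phase_coset U"
  using hom_in_carrier[OF hom, of g]
  by (auto simp: projective_unitary_group_def carrier_FactGroup unitary_group_def)

lemma rep_nonempty: "g \<in> carrier G \<Longrightarrow> \<exists>U. U \<in> \<pi> g"
  using rep_coset[of g] by (auto simp: phase_coset_eq)

lemma rep_unitary: "g \<in> carrier G \<Longrightarrow> U \<in> \<pi> g \<Longrightarrow> unitary U"
  using rep_coset[of g] by (auto simp: phase_coset_eq unitary_compose phase_op_unitary)

lemma rep_eq_coset: "g \<in> carrier G \<Longrightarrow> U \<in> \<pi> g \<Longrightarrow> \<pi> g = phase_coset U"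
proof -
  assume "g \<in> carrier G" "U \<in> \<pi> g"
  then obtain V where V: "\<pi> g = phase_coset V" "U \<in> phase_coset V"
    using rep_coset by blast
  then obtain z where "cmod z = 1" "U = phase_op z o\<^sub>L V"
    by (auto simp: phase_coset_eq)
  then show ?thesis
    using V(1) phase_coset_phase_op by blast
qed

lemma rep_phase: "g \<in> carrier G \<Longrightarrow> U \<in> \<pi> g \<Longrightarrow> cmod z = 1 \<Longrightarrow> phase_op z o\<^sub>L U \<in> \<pi> g"
  using rep_eq_coset[of g U] by (auto simp: phase_coset_eq)

lemma rep_phaseE:
  assumes "g \<in> carrier G" "U \<in> \<pi> g" "V \<in> \<pi> g"
  obtains z where "cmod z = 1" "V = phase_op z o\<^sub>L U"
  using rep_eq_coset[OF assms(1,2)] assms(3) by (auto simp: phase_coset_eq)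

lemma rep_mult:
  assumes "g \<in> carrier G" "h \<in> carrier G" "U \<in> \<pi> g" "V \<in> \<pi> h"
  shows "U o\<^sub>L V \<in> \<pi> (g \<otimes> h)"
  using hom_mult[OF hom assms(1,2)] assms(3,4)
  by (auto simp: projective_unitary_group_def set_mult_def unitary_group_def)

text \<open>The square of \<open>U\<close> lies again in \<open>\<pi> \<one>\<close>, hence is a
  phase times \<open>U\<close>; surjectivity of \<open>U\<close> cancels one factor.\<close>

lemma rep_one:
  assumes "U \<in> \<pi> \<one>"
  obtains z where "cmod z = 1" "U = phase_op z"
proof -
  have "U o\<^sub>L U \<in> \<pi> \<one>"
    using rep_mult[of \<one> \<one> U U] assms by simp
  then obtain z where z: "cmod z = 1" "U o\<^sub>L U = phase_op z o\<^sub>L U"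
    using rep_phaseE[of \<one> U "U o\<^sub>L U"] assms by auto
  have "blinfun_apply U y = z *\<^sub>C y" for y
  proof -
    obtain x where x: "y = blinfun_apply U x"
      using rep_unitary[of \<one> U] assms by (metis one_closed surj_def unitary_def)
    show ?thesis
      using arg_cong[OF z(2), of "\<lambda>A. blinfun_apply A x"] by (simp add: x)
  qed
  then show ?thesis
    using that z(1) by (metis blinfun_eqI phase_op_apply)
qed

lemma rep_inverse:
  assumes "h \<in> carrier G" "B \<in> \<pi> h"
  obtains C where "C \<in> \<pi> (inv h)" "\<And>x. blinfun_apply B (blinfun_apply C x) = x"
proof -
  obtain C where C: "C \<in> \<pi> (inv h)"
    using rep_nonempty assms by blast
  have "B o\<^sub>L C \<in> \<pi> \<one>"
    using rep_mult[of h "inv h" B C] assms C by simp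
  then obtain z where z: "cmod z = 1" "B o\<^sub>L C = phase_op z"
    using rep_one by blast
  have "blinfun_apply B (blinfun_apply C x) = z *\<^sub>C x" for x
    using arg_cong[OF z(2), of "\<lambda>A. blinfun_apply A x"] by simp
  \<comment> \<open>An arbitrary representative of the inverse undoes \<open>B\<close> only up to
    the phase \<open>z\<close>; the conjugate phase makes it an exact right inverse.\<close>
  then have "blinfun_apply B (blinfun_apply (phase_op (cnj z) o\<^sub>L C) x) = x" for x
    using z(1) rep_unitary[OF assms] by (simp add: unitary_scaleC scaleC_scaleC cnj_mult_unit)
  then show ?thesis
    using that rep_phase[of "inv h" C "cnj z"] C z(1) assms by simp
qed

text \<open>Representatives differ by phases, which rays absorb, so all members of the coset
  contribute the same image.\<close>

lemma pu_act_ray: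
  assumes "g \<in> carrier G" "U \<in> \<pi> g"
  shows "pu_act (\<pi> g) (ray x) = ray (blinfun_apply U x)"
proof -
  have "blinfun_apply V ` ray x = ray (blinfun_apply U x)" if "V \<in> \<pi> g" for V
  proof -
    obtain z where z: "cmod z = 1" "V = phase_op z o\<^sub>L U"
      using rep_phaseE[OF assms \<open>V \<in> \<pi> g\<close>] .
    have "blinfun_apply V ` ray x = ray (z *\<^sub>C blinfun_apply U x)"
      using rep_unitary[OF assms]
      by (simp add: ray_def image_image z unitary_scaleC scaleC_scaleC mult.commute)
    moreover have "z \<noteq> 0"
      using z by auto
    ultimately show ?thesis
      by (simp add: ray_scaleC)
  qed
  then show ?thesis
    using assms(2) by (auto simp: pu_act_def)
qed

text \<open>
  Working with a filter on operators, rather than with a chosen lift of \<open>\<pi>\<close>, keeps the whole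
  argument independent of the choice of phases.
\<close>

definition reps_near_one :: "('h \<Rightarrow>\<^sub>L 'h) filter"
  where "reps_near_one = Abs_filter (\<lambda>P. \<forall>\<^sub>F g in nhdsin T \<one>. \<forall>U\<in>\<pi> g. P U)"

lemma eventually_reps_near_one:
  "eventually P reps_near_one \<longleftrightarrow>
    (\<exists>N. openin T N \<and> \<one> \<in> N \<and> (\<forall>g\<in>N. \<forall>U\<in>\<pi> g. P U))"
proof -
  have "is_filter (\<lambda>P. \<forall>\<^sub>F g in nhdsin T \<one>. \<forall>U\<in>\<pi> g. P U)"
  proof
    fix P Q :: "('h \<Rightarrow>\<^sub>L 'h) \<Rightarrow> bool"
    assume P: "\<forall>\<^sub>F g in nhdsin T \<one>. \<forall>U\<in>\<pi> g. P U"
    {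
      assume "\<forall>\<^sub>F g in nhdsin T \<one>. \<forall>U\<in>\<pi> g. Q U"
      with P show "\<forall>\<^sub>F g in nhdsin T \<one>. \<forall>U\<in>\<pi> g. P U \<and> Q U"
        by eventually_elim blast
    }
    {
      assume "\<forall>U. P U \<longrightarrow> Q U"
      with P show "\<forall>\<^sub>F g in nhdsin T \<one>. \<forall>U\<in>\<pi> g. Q U"
        by (auto elim: eventually_mono)
    }
  qed simp
  then show ?thesis
    by (simp add: reps_near_one_def eventually_Abs_filter eventually_nhdsin topspace_eq_carrier)
qed

lemma eventually_reps_near_oneI:
  assumes "openin T N" "\<one> \<in> N" "\<And>g U. g \<in> N \<Longrightarrow> g \<in> carrier G \<Longrightarrow> U \<in> \<pi> g \<Longrightarrow> P U"
  shows "eventually P reps_near_one"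
  using assms openin_subset[OF assms(1)] unfolding eventually_reps_near_one topspace_eq_carrier
  by blast

lemma eventually_unitary: "eventually unitary reps_near_one"
proof (rule eventually_reps_near_oneI)
  show "openin T (carrier G)"
    using openin_topspace[of T] by (simp only: topspace_eq_carrier)
qed (auto intro: rep_unitary)

section \<open>The coefficient at \<open>v\<close> and the subspace of common asymptotic
  phase\<close>

abbreviation vac :: "('h \<Rightarrow>\<^sub>L 'h) \<Rightarrow> complex"
  where "vac U \<equiv> cinner v (blinfun_apply U v)"

lemma norm_vac_le: "unitary U \<Longrightarrow> cmod (vac U) \<le> 1"
  using norm_cinner_le[of v "blinfun_apply U v"] by (simp add: unitary_norm norm_v)

text \<open>For \<open>a < 1\<close> the rays overlapping \<open>v\<close> by more than
  \<open>a\<close> form an open set around the ray of \<open>v\<close>, whose preimage under the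
  orbit map is the required neighbourhood. The upper bound is Cauchy-Schwarz.\<close>

lemma tendsto_norm_vac: "((\<lambda>U. cmod (vac U)) \<longlongrightarrow> 1) reps_near_one"
proof (rule order_tendstoI)
  fix a :: real
  assume a: "a < 1"
  define W where "W = ray ` {w \<in> sphere 0 1. a < cmod (cinner v w)}"
  \<comment> \<open>\<open>W\<close> refers to some unit vector on the ray; as the overlap is the
    same for all of them, its preimage is cut out by the open condition itself.\<close>
  have "{w \<in> sphere 0 1. ray w \<in> W} = sphere 0 1 \<inter> {w. a < cmod (cinner v w)}"
  proof -
    have "a < cmod (cinner v w)" if w: "norm w = 1" "ray w \<in> W" for w
    proof -
      obtain w' where "norm w' = 1" "a < cmod (cinner v w')" "ray w = ray w'"
        using w(2) by (auto simp: W_def)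
      then show ?thesis
        using norm_cinner_ray_cong[of w w' v] w(1) by simp
    qed
    then show ?thesis
      by (auto simp: W_def)
  qed
  moreover have "open {w. a < cmod (cinner v w)}"
    by (intro open_Collect_less continuous_intros cinner.continuous_on)
  ultimately have "openin (top_of_set (sphere 0 1)) {w \<in> sphere 0 1. ray w \<in> W}"
    by (simp add: openin_open_Int)
  moreover have "W \<subseteq> ray ` sphere 0 1"
    by (auto simp: W_def)
  ultimately have "openin projective_space_topology W"
    by (simp add: projective_space_topology_def openin_quotient_topology)
  then have N: "openin T {g \<in> carrier G. pu_act (\<pi> g) (ray v) \<in> W}"
    using openin_continuous_map_preimage[OF orbit] by (simp add: topspace_eq_carrier)
  obtain I where I: "I \<in> \<pi> \<one>"
    using rep_nonempty by blast
  then obtain z where "cmod z = 1" "I = phase_op z"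
    using rep_one by blast
  then have "pu_act (\<pi> \<one>) (ray v) = ray v"
    using pu_act_ray[OF one_closed I, of v] ray_scaleC[of z v] by force
  then have "\<one> \<in> {g \<in> carrier G. pu_act (\<pi> g) (ray v) \<in> W}"
    using a norm_v by (auto simp: W_def cinner_self)
  with N show "\<forall>\<^sub>F U in reps_near_one. a < cmod (vac U)"
  proof (rule eventually_reps_near_oneI)
    fix g U
    assume g: "g \<in> {g \<in> carrier G. pu_act (\<pi> g) (ray v) \<in> W}" "g \<in> carrier G"
      and U: "U \<in> \<pi> g"
    then have "ray (blinfun_apply U v) \<in> W"
      by (simp add: pu_act_ray)
    then obtain w where "norm w = 1" "a < cmod (cinner v w)" "ray (blinfun_apply U v) = ray w"
      by (auto simp: W_def)
    then show "a < cmod (vac U)"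
      using norm_cinner_ray_cong[of "blinfun_apply U v" w v] rep_unitary[OF g(2) U]
      by (simp add: unitary_norm norm_v)
  qed
next
  fix a :: real
  assume a: "1 < a"
  show "\<forall>\<^sub>F U in reps_near_one. cmod (vac U) < a"
    using eventually_unitary by eventually_elim (use a norm_vac_le in fastforce)
qed

text \<open>Multiplying \<open>U\<close> by a phase multiplies the difference by that phase, so
  convergence to 0 does not see the choice of representatives. The coefficient \<open>vac U\<close>
  stands in for the unknown phase.\<close>

definition cont :: "'h set"
  where "cont = {w. ((\<lambda>U. blinfun_apply U w - vac U *\<^sub>C w) \<longlongrightarrow> 0) reps_near_one}"

lemma csubspace_cont: "csubspace cont"
  unfolding csubspace_def
proof (intro conjI ballI allI)
  show "0 \<in> cont"
    by (simp add: cont_def scaleC.zero_right blinfun.zero_right)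
  fix x
  assume x: "x \<in> cont"
  show "x + y \<in> cont" if "y \<in> cont" for y
    using tendsto_add[of _ 0 reps_near_one _ 0] x that
    by (simp add: cont_def blinfun.add_right scaleC_add_right add_diff_add)
  show "c *\<^sub>C x \<in> cont" for c
  proof -
    have "((\<lambda>U. c *\<^sub>C (blinfun_apply U x - vac U *\<^sub>C x)) \<longlongrightarrow> c *\<^sub>C 0) reps_near_one"
      using x unfolding cont_def by (intro scaleC.tendsto tendsto_const) simp
    \<comment> \<open>Bounded operators here are only real linear in general; complex linearity
      comes from unitarity, which holds eventually.\<close>
    moreover have "\<forall>\<^sub>F U in reps_near_one. c *\<^sub>C (blinfun_apply U x - vac U *\<^sub>C x)
        = blinfun_apply U (c *\<^sub>C x) - vac U *\<^sub>C c *\<^sub>C x"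
      using eventually_unitary
      by eventually_elim (simp add: scaleC.diff_right unitary_scaleC scaleC_scaleC mult.commute)
    ultimately show ?thesis
      unfolding cont_def by (simp add: scaleC.zero_right tendsto_cong)
  qed
qed

text \<open>For unitary \<open>U\<close> the operator \<open>U - vac U\<close> has norm at most 2,
  uniformly in \<open>U\<close>; an error below \<open>e / 4\<close> in \<open>x\<close> therefore
  costs less than \<open>e / 2\<close>.\<close>

lemma closed_cont: "closed cont"
proof -
  have "x \<in> cont" if "x \<in> closure cont" for x
    unfolding cont_def mem_Collect_eq
  proof (rule tendstoI)
    fix e :: real
    assume e: "0 < e"
    then have "0 < e / 4"
      by simp
    with \<open>x \<in> closure cont\<close> obtain y where y: "y \<in> cont" "norm (x - y) < e / 4"
      unfolding closure_approachable dist_norm by (metis norm_minus_commute)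
    have "\<forall>\<^sub>F U in reps_near_one. norm (blinfun_apply U y - vac U *\<^sub>C y) < e / 2"
      using tendstoD[of _ 0 reps_near_one "e / 2"] y(1) e unfolding cont_def by fastforce
    with eventually_unitary
    show "\<forall>\<^sub>F U in reps_near_one. dist (blinfun_apply U x - vac U *\<^sub>C x) 0 < e"
    proof eventually_elim
      case (elim U)
      have split: "blinfun_apply U x - vac U *\<^sub>C x = (blinfun_apply U y - vac U *\<^sub>C y)
          + (blinfun_apply U (x - y) - vac U *\<^sub>C (x - y))"
        by (simp add: blinfun.diff_right scaleC.diff_right)
      have "norm (blinfun_apply U x - vac U *\<^sub>C x)
          \<le> norm (blinfun_apply U y - vac U *\<^sub>C y)
            + (norm (blinfun_apply U (x - y)) + norm (vac U *\<^sub>C (x - y)))"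
        unfolding split by (rule order_trans[OF norm_triangle_ineq add_left_mono[OF norm_triangle_ineq4]])
      moreover have "norm (vac U *\<^sub>C (x - y)) \<le> norm (x - y)"
        using norm_vac_le[OF elim(1)] by (simp add: mult_left_le_one_le)
      ultimately show ?case
        using elim y(2) by (simp add: unitary_norm)
    qed
  qed
  then show ?thesis
    by (metis closure_subset_eq subsetI)
qed

text \<open>By Pythagoras the norm in question is the square root of
  \<open>1 - |vac U|^2\<close>.\<close>

lemma v_in_cont: "v \<in> cont"
proof -
  have "((\<lambda>U. sqrt (1 - (cmod (vac U))\<^sup>2)) \<longlongrightarrow> sqrt (1 - 1\<^sup>2)) reps_near_one"
    by (intro tendsto_intros tendsto_norm_vac)
  moreover have "\<forall>\<^sub>F U in reps_near_one.
      sqrt (1 - (cmod (vac U))\<^sup>2) = norm (blinfun_apply U v - vac U *\<^sub>C v)"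
    using eventually_unitary
  proof eventually_elim
    case (elim U)
    then show ?case
      using norm_diff_projection[OF norm_v, of "blinfun_apply U v"]
      by (simp add: unitary_norm norm_v real_sqrt_unique)
  qed
  ultimately have "((\<lambda>U. norm (blinfun_apply U v - vac U *\<^sub>C v)) \<longlongrightarrow> 0) reps_near_one"
    by (simp add: tendsto_cong)
  then show ?thesis
    by (simp add: cont_def tendsto_norm_zero_iff)
qed

section \<open>Conjugation and comparison of phases\<close>

lemma filterlim_conjugate:
  assumes "h \<in> carrier G" "B \<in> \<pi> h" "C \<in> \<pi> (inv h)"
  shows "filterlim (\<lambda>U. C o\<^sub>L (U o\<^sub>L B)) reps_near_one reps_near_one"
  unfolding filterlim_iff
proof (intro allI impI)
  fix P
  assume "eventually P reps_near_one"
  then obtain N where N: "openin T N" "\<one> \<in> N" "\<forall>g\<in>N. \<forall>U\<in>\<pi> g. P U"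
    by (auto simp: eventually_reps_near_one)
  \<comment> \<open>The preimage of \<open>N\<close> under conjugation by \<open>h\<close>, written
    as two translations.\<close>
  define M where "M = {x \<in> carrier G. x \<otimes> h \<in> {y \<in> carrier G. inv h \<otimes> y \<in> N}}"
  have "openin T M"
    unfolding M_def using assms(1) N(1)
    by (intro openin_right_translate openin_left_translate) auto
  moreover have "\<one> \<in> M"
    using assms(1) N(2) by (simp add: M_def)
  ultimately show "\<forall>\<^sub>F U in reps_near_one. P (C o\<^sub>L (U o\<^sub>L B))"
  proof (rule eventually_reps_near_oneI)
    fix g U
    assume g: "g \<in> M" "g \<in> carrier G" and U: "U \<in> \<pi> g"
    have "C o\<^sub>L (U o\<^sub>L B) \<in> \<pi> (inv h \<otimes> (g \<otimes> h))"
      using assms g(2) U by (intro rep_mult) auto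
    then show "P (C o\<^sub>L (U o\<^sub>L B))"
      using g(1) N(3) by (auto simp: M_def)
  qed
qed

text \<open>Conjugate \<open>U\<close> by \<open>B\<close> in the limit defining
  \<open>w \<in> cont\<close>, then apply \<open>B\<close>: now \<open>B w\<close> follows the
  coefficient at \<open>B v\<close> as \<open>w\<close> follows that at \<open>v\<close>. For
  \<open>w = v\<close>, this makes \<open>B v\<close> an asymptotic eigenvector.\<close>

lemma tendsto_conjugate:
  assumes "h \<in> carrier G" "B \<in> \<pi> h" "w \<in> cont"
  defines "v' \<equiv> blinfun_apply B v" and "w' \<equiv> blinfun_apply B w"
  shows "((\<lambda>U. blinfun_apply U w' - cinner v' (blinfun_apply U v') *\<^sub>C w') \<longlongrightarrow> 0) reps_near_one"
proof -
  obtain C where C: "C \<in> \<pi> (inv h)" "\<And>x. blinfun_apply B (blinfun_apply C x) = x"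
    using rep_inverse[OF assms(1,2)] by blast
  note B = rep_unitary[OF assms(1,2)]
  have "((\<lambda>U. blinfun_apply U w - vac U *\<^sub>C w) \<longlongrightarrow> 0) reps_near_one"
    using assms(3) by (simp add: cont_def)
  from filterlim_compose[OF this filterlim_conjugate[OF assms(1,2) C(1)]]
  have "((\<lambda>U. blinfun_apply (C o\<^sub>L (U o\<^sub>L B)) w - vac (C o\<^sub>L (U o\<^sub>L B)) *\<^sub>C w) \<longlongrightarrow> 0)
      reps_near_one" .
  then have "((\<lambda>U. blinfun_apply B
      (blinfun_apply (C o\<^sub>L (U o\<^sub>L B)) w - vac (C o\<^sub>L (U o\<^sub>L B)) *\<^sub>C w)) \<longlongrightarrow> blinfun_apply B 0)
      reps_near_one"
    by (intro blinfun.tendsto tendsto_const)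
  moreover have "vac (C o\<^sub>L (U o\<^sub>L B)) = cinner v' (blinfun_apply U v')" for U
    using unitary_cinner[OF B, of v "blinfun_apply (C o\<^sub>L (U o\<^sub>L B)) v"] by (simp add: C v'_def)
  ultimately show ?thesis
    by (simp add: blinfun.diff_right blinfun.zero_right unitary_scaleC[OF B] C w'_def)
qed

text \<open>Pairing the limit for \<open>B v\<close> with \<open>B v\<close> itself shows that the
  coefficients of \<open>U\<close> at \<open>B v\<close> and at \<open>v\<close> merge. In the
  conjugated limit for \<open>B w\<close> one may then be exchanged for the other.\<close>

lemma cont_invariant:
  assumes "h \<in> carrier G" "B \<in> \<pi> h" "blinfun_apply B v \<in> cont" "w \<in> cont"
  shows "blinfun_apply B w \<in> cont"
proof -
  define v' w' where "v' = blinfun_apply B v" and "w' = blinfun_apply B w"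
  have v': "cinner v' v' = 1"
    using rep_unitary[OF assms(1,2)] by (simp add: v'_def cinner_self unitary_norm norm_v)
  have "((\<lambda>U. blinfun_apply U v' - vac U *\<^sub>C v') \<longlongrightarrow> 0) reps_near_one"
    using assms(3) by (simp add: cont_def v'_def)
  then have "((\<lambda>U. cinner v' (blinfun_apply U v' - vac U *\<^sub>C v') *\<^sub>C w') \<longlongrightarrow> cinner v' 0 *\<^sub>C w')
      reps_near_one"
    by (intro scaleC.tendsto cinner.tendsto tendsto_const)
  then have "((\<lambda>U. (cinner v' (blinfun_apply U v') - vac U) *\<^sub>C w') \<longlongrightarrow> 0) reps_near_one"
    by (simp add: cinner_diff_right cinner_scaleC_right v' cinner.zero_right)
  from tendsto_add[OF tendsto_conjugate[OF assms(1,2,4), folded v'_def w'_def] this]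
  show ?thesis
    by (simp add: cont_def w'_def[symmetric] scaleC.diff_left)
qed

text \<open>Both \<open>v\<close> and \<open>w = B v\<close> are asymptotic eigenvectors. Since
  \<open>U\<close> preserves the nonzero \<open>cinner v w\<close>, the conjugated coefficient at
  \<open>v\<close> times the one at \<open>w\<close> tends to 1; as \<open>|vac U|\<close> tends to
  1, the two coefficients merge.\<close>

lemma cont_if_not_orthogonal:
  assumes "h \<in> carrier G" "B \<in> \<pi> h" "vac B \<noteq> 0"
  shows "blinfun_apply B v \<in> cont"
proof -
  define w where "w = blinfun_apply B v"
  define d1 d2 where "d1 U = blinfun_apply U v - vac U *\<^sub>C v"
    and "d2 U = blinfun_apply U w - cinner w (blinfun_apply U w) *\<^sub>C w" for U
  have norm_w: "norm w = 1"
    using rep_unitary[OF assms(1,2)] by (simp add: w_def unitary_norm norm_v)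
  have d1: "(d1 \<longlongrightarrow> 0) reps_near_one"
    using v_in_cont by (simp add: cont_def d1_def[abs_def])
  have d2: "(d2 \<longlongrightarrow> 0) reps_near_one"
    using tendsto_conjugate[OF assms(1,2) v_in_cont] by (simp add: d2_def[abs_def] w_def)
  let ?b = "\<lambda>U. cinner w (blinfun_apply U w)"
  \<comment> \<open>The majorant for the difference of coefficients: the eigenvector defects,
    divided by the overlap to be cancelled, plus the deviation of \<open>|vac U|^2\<close> from
    1.\<close>
  have "((\<lambda>U. (norm (d1 U) + norm (d2 U)) / cmod (cinner v w) + (1 - (cmod (vac U))\<^sup>2))
      \<longlongrightarrow> (norm (0::'h) + norm (0::'h)) / cmod (cinner v w) + (1 - 1\<^sup>2)) reps_near_one"
    using assms(3) by (intro tendsto_intros d1 d2 tendsto_norm_vac) (simp add: w_def)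
  then have lim: "((\<lambda>U. (norm (d1 U) + norm (d2 U)) / cmod (cinner v w) + (1 - (cmod (vac U))\<^sup>2))
      \<longlongrightarrow> 0) reps_near_one"
    by simp
  have bound: "\<forall>\<^sub>F U in reps_near_one. norm (vac U - ?b U)
      \<le> (norm (d1 U) + norm (d2 U)) / cmod (cinner v w) + (1 - (cmod (vac U))\<^sup>2)"
    using eventually_unitary
  proof eventually_elim
    case (elim U)
    \<comment> \<open>Insert the eigenvector approximations into the preserved inner product, first
      for \<open>U v\<close>, then for \<open>U w\<close>.\<close>
    have "cinner v w = cinner (d1 U + vac U *\<^sub>C v) (blinfun_apply U w)"
      using unitary_cinner[OF elim, of v w] by (simp add: d1_def)
    also have "\<dots> = cinner (d1 U) (blinfun_apply U w) + cnj (vac U) * cinner v (d2 U + ?b U *\<^sub>C w)"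
      by (simp add: cinner_add_left cinner_scaleC_left d2_def)
    finally have "(1 - cnj (vac U) * ?b U) * cinner v w
        = cinner (d1 U) (blinfun_apply U w) + cnj (vac U) * cinner v (d2 U)"
      by (simp add: cinner_add_right cinner_scaleC_right algebra_simps)
    then have "cmod (1 - cnj (vac U) * ?b U) * cmod (cinner v w)
        \<le> cmod (cinner (d1 U) (blinfun_apply U w)) + cmod (vac U) * cmod (cinner v (d2 U))"
      using norm_triangle_ineq[of "cinner (d1 U) (blinfun_apply U w)" "cnj (vac U) * cinner v (d2 U)"]
      by (simp only: norm_mult[symmetric] complex_mod_cnj[of "vac U", symmetric])
    moreover have "cmod (cinner (d1 U) (blinfun_apply U w)) \<le> norm (d1 U)"
      using norm_cinner_le[of "d1 U" "blinfun_apply U w"] by (simp add: unitary_norm[OF elim] norm_w)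
    moreover have "cmod (vac U) * cmod (cinner v (d2 U)) \<le> 1 * norm (d2 U)"
      using norm_cinner_le[of v "d2 U"] norm_vac_le[OF elim] norm_v by (intro mult_mono) auto
    ultimately have *: "cmod (1 - cnj (vac U) * ?b U) \<le> (norm (d1 U) + norm (d2 U)) / cmod (cinner v w)"
      using assms(3) by (simp add: w_def pos_le_divide_eq)
    \<comment> \<open>Multiplying by \<open>vac U\<close> instead of dividing by its conjugate
      avoids a possible zero, at the cost of a term with \<open>1 - |vac U|^2\<close>.\<close>
    have split: "vac U - ?b U
        = vac U * (1 - cnj (vac U) * ?b U) - complex_of_real (1 - (cmod (vac U))\<^sup>2) * ?b U"
      by (simp add: mult_cnj_cmod[symmetric] algebra_simps)
    have "cmod (complex_of_real (1 - (cmod (vac U))\<^sup>2)) = 1 - (cmod (vac U))\<^sup>2"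
      unfolding norm_of_real using norm_vac_le[OF elim] by (simp add: power_le_one)
    then have "norm (vac U - ?b U)
        \<le> cmod (vac U) * cmod (1 - cnj (vac U) * ?b U) + (1 - (cmod (vac U))\<^sup>2) * cmod (?b U)"
      unfolding split
      using norm_triangle_ineq4[of "vac U * (1 - cnj (vac U) * ?b U)"
          "complex_of_real (1 - (cmod (vac U))\<^sup>2) * ?b U"]
      by (simp only: norm_mult)
    moreover have "cmod (?b U) \<le> 1"
      using norm_cinner_le[of w "blinfun_apply U w"] by (simp add: unitary_norm[OF elim] norm_w)
    then have "(1 - (cmod (vac U))\<^sup>2) * cmod (?b U) \<le> 1 - (cmod (vac U))\<^sup>2"
      using norm_vac_le[OF elim] by (intro mult_right_le_one_le) (auto simp: power_le_one)
    moreover have "cmod (vac U) * cmod (1 - cnj (vac U) * ?b U) \<le> cmod (1 - cnj (vac U) * ?b U)"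
      using norm_vac_le[OF elim] by (intro mult_left_le_one_le) auto
    ultimately show ?case
      using * by linarith
  qed
  have "((\<lambda>U. vac U - ?b U) \<longlongrightarrow> 0) reps_near_one"
    by (rule Lim_null_comparison[OF bound lim])
  \<comment> \<open>Subtracting this multiple of \<open>w\<close> exchanges the coefficient at
    \<open>w\<close> in \<open>d2\<close> for \<open>vac U\<close>.\<close>
  then have "((\<lambda>U. d2 U - (vac U - ?b U) *\<^sub>C w) \<longlongrightarrow> 0 - 0 *\<^sub>C w) reps_near_one"
    by (intro tendsto_diff d2 scaleC.tendsto tendsto_const)
  then show ?thesis
    by (simp add: cont_def d2_def scaleC.diff_left w_def[symmetric])
qed

section \<open>Connectedness and irreducibility\<close>

lemma orbit_in_cont:
  assumes "connected_space T" "g \<in> carrier G" "B \<in> \<pi> g"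
  shows "blinfun_apply B v \<in> cont"
proof -
  \<comment> \<open>Near the unit the overlap with \<open>v\<close> is nonzero, so \<open>K\<close>
    contains a neighbourhood \<open>N\<close> of the unit; closure under products then makes it open
    and closed.\<close>
  define K where "K = {h \<in> carrier G. \<forall>B\<in>\<pi> h. blinfun_apply B v \<in> cont}"
  have "\<forall>\<^sub>F U in reps_near_one. 0 < cmod (vac U)"
    by (rule order_tendstoD(1)[OF tendsto_norm_vac zero_less_one])
  then obtain N where N: "openin T N" "\<one> \<in> N" "\<forall>g\<in>N. \<forall>U\<in>\<pi> g. 0 < cmod (vac U)"
    unfolding eventually_reps_near_one by blast
  have "N \<subseteq> K"
    using N(3) openin_subset[OF N(1)] cont_if_not_orthogonal
    by (auto simp: K_def topspace_eq_carrier)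
  have K_mult: "h \<otimes> k \<in> K" if "h \<in> K" "k \<in> K" for h k
  proof -
    have hk: "h \<in> carrier G" "k \<in> carrier G"
      using that by (auto simp: K_def)
    have "blinfun_apply X v \<in> cont" if X: "X \<in> \<pi> (h \<otimes> k)" for X
    proof -
      obtain B C where B: "B \<in> \<pi> h" and C: "C \<in> \<pi> k"
        using rep_nonempty hk by blast
      obtain z where "X = phase_op z o\<^sub>L (B o\<^sub>L C)"
        using rep_phaseE[OF _ rep_mult[OF hk B C] X] hk by blast
      \<comment> \<open>As \<open>B v\<close> lies in \<open>cont\<close>, the operator
        \<open>B\<close> preserves \<open>cont\<close> and keeps \<open>C v\<close> there.\<close>
      moreover have "blinfun_apply B (blinfun_apply C v) \<in> cont"
        using \<open>h \<in> K\<close> \<open>k \<in> K\<close> B C cont_invariant[OF hk(1) B] by (simp add: K_def)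
      ultimately show ?thesis
        by (simp add: csubspace_scaleC[OF csubspace_cont])
    qed
    then show ?thesis
      using hk by (simp add: K_def)
  qed
  have K_sub: "K \<subseteq> carrier G"
    by (auto simp: K_def)
  have "openin T K"
  proof (subst openin_subopen, intro ballI)
    fix x
    assume "x \<in> K"
    then have x: "x \<in> carrier G"
      using K_sub by blast
    \<comment> \<open>This is the translate \<open>x N\<close>, contained in \<open>K K\<close> and
      hence in \<open>K\<close>.\<close>
    have "openin T {y \<in> carrier G. inv x \<otimes> y \<in> N}"
      using x N(1) by (intro openin_left_translate) auto
    moreover have "x \<in> {y \<in> carrier G. inv x \<otimes> y \<in> N}"
      using x N(2) by simp
    moreover have "{y \<in> carrier G. inv x \<otimes> y \<in> N} \<subseteq> K"
    proof safe
      fix y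
      assume y: "y \<in> carrier G" "inv x \<otimes> y \<in> N"
      have "x \<otimes> (inv x \<otimes> y) \<in> K"
        using K_mult \<open>x \<in> K\<close> y(2) \<open>N \<subseteq> K\<close> by blast
      then show "y \<in> K"
        using x y by (simp add: m_assoc[symmetric])
    qed
    ultimately show "\<exists>M. openin T M \<and> x \<in> M \<and> M \<subseteq> K"
      by blast
  qed
  moreover have "openin T (topspace T - K)"
  proof (subst openin_subopen, intro ballI)
    fix x
    assume "x \<in> topspace T - K"
    then have x: "x \<in> carrier G" "x \<notin> K"
      by (auto simp: topspace_eq_carrier)
    \<comment> \<open>These are the \<open>y\<close> with \<open>x\<close> in \<open>y N\<close>; a
      member of \<open>K\<close> among them would put \<open>x\<close> into
      \<open>K\<close>.\<close>
    define M where "M = {y \<in> carrier G. inv y \<in> {z \<in> carrier G. z \<otimes> x \<in> N}}"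
    have "openin T M"
      unfolding M_def using x N(1) by (intro openin_inverse openin_right_translate) auto
    moreover have "x \<in> M"
      using x N(2) by (simp add: M_def)
    moreover have "y \<notin> K" if "y \<in> M" for y
    proof
      assume "y \<in> K"
      have y: "y \<in> carrier G" "inv y \<otimes> x \<in> N"
        using that by (auto simp: M_def)
      have "y \<otimes> (inv y \<otimes> x) \<in> K"
        using K_mult \<open>y \<in> K\<close> y(2) \<open>N \<subseteq> K\<close> by blast
      then show False
        using x y by (simp add: m_assoc[symmetric])
    qed
    then have "M \<subseteq> topspace T - K"
      by (auto simp: M_def topspace_eq_carrier)
    ultimately show "\<exists>M. openin T M \<and> x \<in> M \<and> M \<subseteq> topspace T - K"
      by blast
  qed
  ultimately have "K = {} \<or> K = topspace T"
    using assms(1) K_sub unfolding connected_space_clopen_in closedin_def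
    by (simp add: topspace_eq_carrier)
  then have "K = carrier G"
    using N(2) \<open>N \<subseteq> K\<close> by (auto simp: topspace_eq_carrier)
  then show ?thesis
    using assms(2,3) by (auto simp: K_def)
qed

text \<open>All orbit vectors \<open>B v\<close> lie in \<open>cont\<close>, so every representative
  preserves it; \<open>v\<close> excludes the zero subspace.\<close>

lemma cont_eq_UNIV:
  assumes "connected_space T" "irreducible_rep G \<pi>"
  shows "cont = UNIV"
proof -
  have "pu_act (\<pi> g) cont \<subseteq> cont" if "g \<in> carrier G" for g
    using orbit_in_cont[OF assms(1)] cont_invariant that by (auto simp: pu_act_def)
  then have "cont = {0} \<or> cont = UNIV"
    using assms(2) csubspace_cont closed_cont unfolding irreducible_rep_def by blast
  moreover have "v \<noteq> 0"
    using norm_v by force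
  ultimately show ?thesis
    using v_in_cont by blast
qed

section \<open>Removal of the phase and strong continuity\<close>

lemma tendsto_normalised:
  assumes "w \<in> cont"
  shows "((\<lambda>U. cnj (sgn (vac U)) *\<^sub>C blinfun_apply U w) \<longlongrightarrow> w) reps_near_one"
proof -
  have "((\<lambda>U. blinfun_apply U w - vac U *\<^sub>C w) \<longlongrightarrow> 0) reps_near_one"
    using assms by (simp add: cont_def)
  from tendsto_add[OF tendsto_norm_zero[OF this]
      tendsto_mult_left_zero[OF tendsto_rabs_zero[OF LIM_zero[OF tendsto_norm_vac]]]]
  have lim: "((\<lambda>U. norm (blinfun_apply U w - vac U *\<^sub>C w) + \<bar>cmod (vac U) - 1\<bar> * norm w)
      \<longlongrightarrow> 0) reps_near_one"
    by simp
  have "norm (cnj (sgn (vac U)) *\<^sub>C blinfun_apply U w - w)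
      \<le> norm (blinfun_apply U w - vac U *\<^sub>C w) + \<bar>cmod (vac U) - 1\<bar> * norm w" for U
  proof -
    \<comment> \<open>Since \<open>sgn 0 = 0\<close>, the modulus of \<open>?s\<close> is at most 1
      even for a vanishing coefficient, and the bound holds for every \<open>U\<close>.\<close>
    let ?s = "cnj (sgn (vac U))"
    have "?s * vac U = complex_of_real (cmod (vac U))"
      using mult_cnj_cmod[of "vac U"]
      by (simp add: sgn_eq power2_eq_square mult.commute)
    then have "?s *\<^sub>C blinfun_apply U w - w
        = ?s *\<^sub>C (blinfun_apply U w - vac U *\<^sub>C w) + complex_of_real (cmod (vac U) - 1) *\<^sub>C w"
      by (simp add: scaleC.diff_right scaleC.diff_left scaleC_scaleC)
    then have "norm (?s *\<^sub>C blinfun_apply U w - w)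
        \<le> cmod ?s * norm (blinfun_apply U w - vac U *\<^sub>C w)
          + cmod (complex_of_real (cmod (vac U) - 1)) * norm w"
      using norm_triangle_ineq[of "?s *\<^sub>C (blinfun_apply U w - vac U *\<^sub>C w)"
          "complex_of_real (cmod (vac U) - 1) *\<^sub>C w"]
      by (simp only: norm_scaleC)
    moreover have "cmod ?s * norm (blinfun_apply U w - vac U *\<^sub>C w)
        \<le> norm (blinfun_apply U w - vac U *\<^sub>C w)"
      by (intro mult_left_le_one_le) (auto simp: norm_sgn)
    ultimately show ?thesis
      unfolding norm_of_real by linarith
  qed
  then have "((\<lambda>U. cnj (sgn (vac U)) *\<^sub>C blinfun_apply U w - w) \<longlongrightarrow> 0) reps_near_one"
    by (intro Lim_null_comparison[OF _ lim] always_eventually) blast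
  then show ?thesis
    by (rule LIM_zero_cancel)
qed

text \<open>Convergence at the unit is carried to \<open>g\<close> by a fixed \<open>B\<close> in
  \<open>\<pi> g\<close>: with \<open>U\<close> normalised, the product of \<open>B\<close> and
  \<open>U\<close> tends strongly to \<open>B\<close>, and the coset forgets the normalising
  phase.\<close>

lemma continuous_rep:
  assumes "cont = UNIV"
  shows "continuous_map T projective_unitary_topology \<pi>"
proof -
  have top: "topspace unitary_topology = Collect unitary"
    by (simp add: unitary_topology_def unitary_group_def strong_operator_topology_topspace)
  have "openin T {g \<in> carrier G. \<pi> g \<in> W}" if W: "openin projective_unitary_topology W" for W
  proof -
    have "openin unitary_topology {U. unitary U \<and> phase_coset U \<in> W}"
      using W by (simp add: projective_unitary_topology_def openin_quotient_topology top)
    then obtain O' where O': "openin strong_operator_topology O'"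
      "{U. unitary U \<and> phase_coset U \<in> W} = O' \<inter> Collect unitary"
      by (auto simp: unitary_topology_def openin_subtopology unitary_group_def)
    show ?thesis
    proof (subst openin_subopen, intro ballI)
      fix g
      assume "g \<in> {g \<in> carrier G. \<pi> g \<in> W}"
      then have g: "g \<in> carrier G" "\<pi> g \<in> W"
        by auto
      then obtain B where B: "B \<in> \<pi> g"
        using rep_nonempty by blast
      have "B \<in> {U. unitary U \<and> phase_coset U \<in> W}"
        using g(2) rep_unitary[OF g(1) B] by (simp flip: rep_eq_coset[OF g(1) B])
      then have "B \<in> O'"
        unfolding O'(2) by simp
      let ?f = "\<lambda>U. B o\<^sub>L (phase_op (cnj (sgn (vac U))) o\<^sub>L U)"
      have "limitin strong_operator_topology ?f B reps_near_one"
      proof (rule limitin_strong_operator_topology)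
        fix x
        have "((\<lambda>U. blinfun_apply B (cnj (sgn (vac U)) *\<^sub>C blinfun_apply U x))
            \<longlongrightarrow> blinfun_apply B x) reps_near_one"
          using assms by (intro blinfun.tendsto tendsto_const tendsto_normalised) simp
        then show "((\<lambda>U. blinfun_apply (?f U) x) \<longlongrightarrow> blinfun_apply B x) reps_near_one"
          by simp
      qed
      then have "\<forall>\<^sub>F U in reps_near_one. ?f U \<in> O'"
        using O'(1) \<open>B \<in> O'\<close> by (auto simp: limitin_def)
      \<comment> \<open>A nonzero coefficient makes the normalising factor a genuine phase, so that
        \<open>?f U\<close> is unitary.\<close>
      moreover have "\<forall>\<^sub>F U in reps_near_one. 0 < cmod (vac U)"
        by (rule order_tendstoD(1)[OF tendsto_norm_vac zero_less_one])
      ultimately have "\<forall>\<^sub>F U in reps_near_one. phase_coset (B o\<^sub>L U) \<in> W"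
        using eventually_unitary
      proof eventually_elim
        case (elim U)
        let ?z = "cnj (sgn (vac U))"
        have z: "cmod ?z = 1"
          using elim(2) by (simp add: norm_sgn)
        have "unitary (?f U)"
          using z elim(3) rep_unitary[OF g(1) B] by (simp add: unitary_compose phase_op_unitary)
        then have "?f U \<in> {U. unitary U \<and> phase_coset U \<in> W}"
          unfolding O'(2) using elim(1) by simp
        then have "phase_coset (?f U) \<in> W"
          by simp
        \<comment> \<open>Complex linearity of \<open>B\<close> moves the phase to the left, where
          the coset absorbs it.\<close>
        moreover have "?f U = phase_op ?z o\<^sub>L (B o\<^sub>L U)"
          by (rule blinfun_eqI) (simp add: unitary_scaleC[OF rep_unitary[OF g(1) B]])
        ultimately show ?case
          by (simp add: phase_coset_phase_op[OF z])
      qed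
      then obtain N where N: "openin T N" "\<one> \<in> N"
        "\<forall>k\<in>N. \<forall>U\<in>\<pi> k. phase_coset (B o\<^sub>L U) \<in> W"
        by (auto simp: eventually_reps_near_one)
      have "\<pi> x \<in> W" if x: "x \<in> carrier G" "inv g \<otimes> x \<in> N" for x
      proof -
        obtain U where U: "U \<in> \<pi> (inv g \<otimes> x)"
          using rep_nonempty g(1) x(1) by blast
        have "B o\<^sub>L U \<in> \<pi> (g \<otimes> (inv g \<otimes> x))"
          using rep_mult[OF g(1) _ B U] g(1) x(1) by simp
        then have "B o\<^sub>L U \<in> \<pi> x"
          using g(1) x(1) by (simp add: m_assoc[symmetric])
        from rep_eq_coset[OF x(1) this] show ?thesis
          using N(3) x(2) U by simp
      qed
      moreover have "openin T {x \<in> carrier G. inv g \<otimes> x \<in> N}"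
        using g(1) N(1) by (intro openin_left_translate) auto
      ultimately show "\<exists>M. openin T M \<and> g \<in> M \<and> M \<subseteq> {g \<in> carrier G. \<pi> g \<in> W}"
        using g(1) N(2) by (intro exI[of _ "{x \<in> carrier G. inv g \<otimes> x \<in> N}"]) auto
    qed
  qed
  moreover have "\<pi> g \<in> topspace projective_unitary_topology" if "g \<in> carrier G" for g
    using rep_coset[OF that]
    by (auto simp: projective_unitary_topology_def topspace_quotient_topology top)
  ultimately show ?thesis
    by (auto simp: continuous_map_def topspace_eq_carrier)
qed

end

theorem corollary4p16:
  fixes G :: "('g, 'm) monoid_scheme"
    and T :: "'g topology"
    and \<pi> :: "'g \<Rightarrow> ('h::chilbert_space \<Rightarrow>\<^sub>L 'h) set"
  assumes "topological_group G T"
    and "connected_space T"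
    and "projective_rep G \<pi>"
    and "irreducible_rep G \<pi>"
    and "\<exists>r\<in>projective_space. continuous_map T projective_space_topology (\<lambda>g. pu_act (\<pi> g) r)"
  shows "continuous_map T projective_unitary_topology \<pi>"
proof -
  obtain x where x: "x \<noteq> 0"
    "continuous_map T projective_space_topology (\<lambda>g. pu_act (\<pi> g) (ray x))"
    using assms(5) by (auto simp: projective_space_def)
  \<comment> \<open>Rescaling to a unit vector keeps the ray and hence its orbit map.\<close>
  define v where "v = complex_of_real (1 / norm x) *\<^sub>C x"
  have "norm v = 1" "ray v = ray x"
    using x(1) by (simp_all add: v_def ray_scaleC norm_divide)
  then interpret projective_unitary_rep G T \<pi> v
    using assms(1,3) x(2)
    by (simp add: projective_unitary_rep_def projective_unitary_rep_axioms_def projective_rep_def)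
  show ?thesis
    using continuous_rep cont_eq_UNIV assms(2,4) by blast
qed

end
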